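(* Let $U,V\subset\mathbb R^3$ be domains, $(s,t)\subset\mathbb R$ an open interval, $\underline a=\sum_{i=1}^3a_ie_i\in C^1(U,V)$ a diffeomorphism with real-valued components, and $a:(s,t)\times U\to(s,t)\times V$, $a(x)=x_0+\underline a(\underline x)$. Let $\Omega\subset\mathbb H$ be a domain and let $\mathcal T(x)=(\alpha x+\beta)(\gamma x+\delta)^{-1}$ be a quaternionic Möbius transformation with $\alpha,\beta,\gamma,\delta\in\mathbb H$, $\gamma\ne0$, $\beta-\alpha\gamma^{-1}\delta\neq0$, such that $$\alpha\overline\gamma,\quad(\beta-\alpha\gamma^{-1}\delta)\overline\gamma,\quad\delta\,\overline{(\beta-\alpha\gamma^{-1}\delta)}\ \in\mathbb R,$$ $\gamma x+\delta\ne0$ for $x\in\Omega$, and $\Omega,\mathcal T(\Omega)\subset(s,t)\times V$. Then for $f\in C^1(a^{-1}(\mathcal T(\Omega)),\mathbb H)$: $\mathcal H_a(f)=0$ on $a^{-1}(\mathcal T(\Omega))$ if and only if the function $\overline\gamma\,(f\circ a^{-1}\circ\mathcal T\circ a)$ on $a^{-1}(\Omega)$ satisfies $\mathcal H_a\big(\overline\gamma\,(f\circ a^{-1}\circ\mathcal T\circ a)\big)=0$ on $a^{-1}(\Omega)$.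
   Context: $\mathbb H$ is the skew-field of quaternions with imaginary units $e_1,e_2,e_3$; $x=x_0+\underline x$, $\underline x=\sum_{k=1}^3x_ke_k$, $\overline x=x_0-\underline x$; $\mathbb R\times\mathbb R^3=\mathbb H$. "Diffeomorphism" means a $C^1$ bijection with $C^1$ inverse; $(a^{-1})_j$ is the $j$-th real component of $(\underline a)^{-1}$. On $C^1$ functions on open subsets of $(s,t)\times U$, $$\mathcal H_a(f)=\underline a\frac{\partial f}{\partial x_0}-\sum_{i=1}^3\Big(\sum_{j=1}^3a_j\Big(\frac{\partial(a^{-1})_i}{\partial y_j}\circ a\Big)\Big)\frac{\partial f}{\partial x_i}.$$ *)

theory Defs
  imports "HOL-Analysis.Analysis"
begin

text \<open>
  A quaternion is written as \<open>Quat x\<^sub>0 v\<close> with real part \<open>x\<^sub>0\<close> and vector part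
  \<open>v = (x\<^sub>1, x\<^sub>2, x\<^sub>3)\<close>, which is the identification of the quaternions with \<open>\<real> \<times> \<real>\<^sup>3\<close>.
  The product is \<open>(a + v)(b + w) = ab - v \<bullet> w + aw + bv + v \<times> w\<close>.
\<close>

datatype quat = Quat (qRe: real) (qVec: "real ^ 3")

lemma quat_eq_iff: "x = y \<longleftrightarrow> qRe x = qRe y \<and> qVec x = qVec y"
  by (cases x; cases y) auto

definition qcnj :: "quat \<Rightarrow> quat" where
  "qcnj x = Quat (qRe x) (- qVec x)"

definition pure_quat :: "real ^ 3 \<Rightarrow> quat" where
  "pure_quat v = Quat 0 v"

definition qunit :: "3 \<Rightarrow> quat" where
  "qunit k = pure_quat (axis k 1)"

instantiation quat :: real_normed_div_algebra
begin

definition zero_quat :: quat where "0 = Quat 0 0"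
definition one_quat :: quat where "1 = Quat 1 0"
definition plus_quat :: "quat \<Rightarrow> quat \<Rightarrow> quat" where
  "x + y = Quat (qRe x + qRe y) (qVec x + qVec y)"
definition minus_quat :: "quat \<Rightarrow> quat \<Rightarrow> quat" where
  "x - y = Quat (qRe x - qRe y) (qVec x - qVec y)"
definition uminus_quat :: "quat \<Rightarrow> quat" where
  "- x = Quat (- qRe x) (- qVec x)"
definition scaleR_quat :: "real \<Rightarrow> quat \<Rightarrow> quat" where
  "r *\<^sub>R x = Quat (r * qRe x) (r *\<^sub>R qVec x)"
definition times_quat :: "quat \<Rightarrow> quat \<Rightarrow> quat" where
  "x * y = Quat (qRe x * qRe y - qVec x \<bullet> qVec y)
                (qRe x *\<^sub>R qVec y + qRe y *\<^sub>R qVec x + cross3 (qVec x) (qVec y))"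
definition norm_quat :: "quat \<Rightarrow> real" where
  "norm (x :: quat) = sqrt ((qRe x)\<^sup>2 + (norm (qVec x))\<^sup>2)"
definition inverse_quat :: "quat \<Rightarrow> quat" where
  "inverse (x :: quat) = inverse ((norm x)\<^sup>2) *\<^sub>R qcnj x"
definition divide_quat :: "quat \<Rightarrow> quat \<Rightarrow> quat" where
  "x div (y :: quat) = x * inverse y"
definition sgn_quat :: "quat \<Rightarrow> quat" where
  "sgn (x :: quat) = inverse (norm x) *\<^sub>R x"
definition dist_quat :: "quat \<Rightarrow> quat \<Rightarrow> real" where
  "dist x (y :: quat) = norm (x - y)"
definition uniformity_quat :: "(quat \<times> quat) filter" where
  "uniformity_quat = (INF e\<in>{0<..}. principal {(x, y). dist x (y :: quat) < e})"
definition open_quat :: "quat set \<Rightarrow> bool" where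
  "open_quat S = (\<forall>x\<in>S. \<forall>\<^sub>F (x', y) in uniformity. x' = x \<longrightarrow> y \<in> S)"

lemmas quat_alg_defs = zero_quat_def one_quat_def plus_quat_def minus_quat_def
  uminus_quat_def scaleR_quat_def times_quat_def quat_eq_iff

lemmas quat_coord_simps = vec_eq_iff forall_3 inner_vec_def sum_3 cross3_def

lemma norm_quat_Pair: "norm x = norm (qRe x, qVec x)" for x :: quat
  by (simp add: norm_quat_def norm_Pair)

lemma norm_quat_sq: "(norm x)\<^sup>2 = (qRe x)\<^sup>2 + (qVec x) \<bullet> (qVec x)" for x :: quat
  by (simp add: norm_quat_def power2_norm_eq_inner)

instance
proof
  fix a b c x y :: quat and r s :: real
  show "a + b + c = a + (b + c)" "a + b = b + a" "0 + a = a" "- a + a = 0" "a - b = a + - b"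
    "r *\<^sub>R (a + b) = r *\<^sub>R a + r *\<^sub>R b" "(r + s) *\<^sub>R a = r *\<^sub>R a + s *\<^sub>R a"
    "r *\<^sub>R s *\<^sub>R a = (r * s) *\<^sub>R a" "1 *\<^sub>R a = a"
    by (simp_all add: quat_alg_defs algebra_simps)
  show "a * b * c = a * (b * c)" "(a + b) * c = a * c + b * c" "a * (b + c) = a * b + a * c"
    "r *\<^sub>R a * b = r *\<^sub>R (a * b)" "a * r *\<^sub>R b = r *\<^sub>R (a * b)"
    by (simp_all add: quat_alg_defs quat_coord_simps algebra_simps)
  show "1 * a = a" "a * 1 = a" "(0 :: quat) \<noteq> 1"
    by (simp_all add: quat_alg_defs)
  show "norm x = 0 \<longleftrightarrow> x = 0"
    by (simp add: norm_quat_Pair quat_alg_defs zero_prod_def)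
  show "norm (x + y) \<le> norm x + norm y"
    using norm_triangle_ineq[of "(qRe x, qVec x)" "(qRe y, qVec y)"]
    by (simp add: norm_quat_Pair plus_quat_def)
  show "norm (r *\<^sub>R x) = \<bar>r\<bar> * norm x"
    using norm_scaleR[of r "(qRe x, qVec x)"]
    by (simp add: norm_quat_Pair scaleR_quat_def)
  have "(norm (x * y))\<^sup>2 = (norm x * norm y)\<^sup>2"
    unfolding power_mult_distrib norm_quat_sq
    by (simp add: times_quat_def inner_vec_def sum_3 cross3_def power2_eq_square algebra_simps)
  then show "norm (x * y) = norm x * norm y"
    by (rule power2_eq_imp_eq) (simp_all add: norm_quat_def)
  have *: "x * qcnj x = ((norm x)\<^sup>2) *\<^sub>R 1" "qcnj x * x = ((norm x)\<^sup>2) *\<^sub>R 1"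
    unfolding norm_quat_sq
    by (simp_all add: qcnj_def quat_alg_defs quat_coord_simps power2_eq_square algebra_simps)
  have **: "r *\<^sub>R a * b = r *\<^sub>R (a * b)" "a * r *\<^sub>R b = r *\<^sub>R (a * b)" for r and a b :: quat
    by (simp_all add: quat_alg_defs quat_coord_simps algebra_simps)
  show "inverse x * x = 1" "x * inverse x = 1" if "x \<noteq> 0"
  proof -
    have "(norm x)\<^sup>2 \<noteq> 0"
      using that by (auto simp: norm_quat_Pair quat_alg_defs zero_prod_def)
    then show "inverse x * x = 1" "x * inverse x = 1"
      unfolding inverse_quat_def ** * by (simp_all add: quat_alg_defs)
  qed
  show "inverse (0 :: quat) = 0"
    by (simp add: inverse_quat_def qcnj_def quat_alg_defs)
qed (simp_all add: dist_quat_def sgn_quat_def divide_quat_def open_quat_def uniformity_quat_def)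

end

lemma qunit_mult:
  "qunit 1 * qunit 1 = -1" "qunit 2 * qunit 2 = -1" "qunit 3 * qunit 3 = -1"
  "qunit 1 * qunit 2 = qunit 3" "qunit 2 * qunit 3 = qunit 1" "qunit 3 * qunit 1 = qunit 2"
  by (simp_all add: qunit_def pure_quat_def quat_alg_defs quat_coord_simps axis_def)

lemma quat_expand: "x = of_real (qRe x) + (\<Sum>k\<in>UNIV. (qVec x $ k) *\<^sub>R qunit k)"
  by (simp add: of_real_def qunit_def pure_quat_def quat_alg_defs quat_coord_simps axis_def)

definition is_domain :: "'a::topological_space set \<Rightarrow> bool" where
  "is_domain S \<longleftrightarrow> open S \<and> connected S \<and> S \<noteq> {}"

text \<open>Derivatives are two-sided, so this is meant for open \<open>S\<close>.\<close>

definition C1_on :: "('a::real_normed_vector \<Rightarrow> 'b::real_normed_vector) \<Rightarrow> 'a set \<Rightarrow> bool" where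
  "C1_on f S \<longleftrightarrow>
     (\<exists>f' :: 'a \<Rightarrow> 'a \<Rightarrow>\<^sub>L 'b.
        (\<forall>x\<in>S. (f has_derivative blinfun_apply (f' x)) (at x)) \<and> continuous_on S f')"

definition C1_diffeomorphism ::
    "('a::real_normed_vector \<Rightarrow> 'b::real_normed_vector) \<Rightarrow> 'a set \<Rightarrow> 'b set \<Rightarrow> bool" where
  "C1_diffeomorphism f S T \<longleftrightarrow> bij_betw f S T \<and> C1_on f S \<and> C1_on (inv_into S f) T"

definition partial_deriv ::
    "('a::real_normed_vector \<Rightarrow> 'b::real_normed_vector) \<Rightarrow> 'a \<Rightarrow> 'a \<Rightarrow> 'b" where
  "partial_deriv f e x = vector_derivative (\<lambda>h. f (x + h *\<^sub>R e)) (at 0)"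

text \<open>The set \<open>(s, t) \<times> U\<close>; the endpoints may be infinite.\<close>

definition cyl :: "ereal \<Rightarrow> ereal \<Rightarrow> (real ^ 3) set \<Rightarrow> quat set" where
  "cyl s t U = {x. qRe x \<in> einterval s t \<and> qVec x \<in> U}"

definition qlift :: "(real ^ 3 \<Rightarrow> real ^ 3) \<Rightarrow> quat \<Rightarrow> quat" where
  "qlift a x = of_real (qRe x) + pure_quat (a (qVec x))"

text \<open>The inverse is the one from \<open>(s, t) \<times> V\<close> to \<open>(s, t) \<times> U\<close>.\<close>

definition qlift_inv ::
    "ereal \<Rightarrow> ereal \<Rightarrow> (real ^ 3) set \<Rightarrow> (real ^ 3 \<Rightarrow> real ^ 3) \<Rightarrow> quat \<Rightarrow> quat" where
  "qlift_inv s t U a = inv_into (cyl s t U) (qlift a)"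

text \<open>
  Here \<open>inv_into U a\<close> is the inverse of the three-dimensional map, not of \<open>qlift a\<close>.
\<close>

definition H_op ::
    "(real ^ 3) set \<Rightarrow> (real ^ 3 \<Rightarrow> real ^ 3) \<Rightarrow> (quat \<Rightarrow> quat) \<Rightarrow> quat \<Rightarrow> quat" where
  "H_op U a f x =
     pure_quat (a (qVec x)) * partial_deriv f 1 x
     - (\<Sum>i\<in>UNIV.
          (\<Sum>j\<in>UNIV. a (qVec x) $ j
             * partial_deriv (\<lambda>y. inv_into U a y $ i) (axis j 1) (a (qVec x)))
          *\<^sub>R partial_deriv f (qunit i) x)"

definition qmoebius :: "quat \<Rightarrow> quat \<Rightarrow> quat \<Rightarrow> quat \<Rightarrow> quat \<Rightarrow> quat" where
  "qmoebius \<alpha> \<beta> \<gamma> \<delta> x = (\<alpha> * x + \<beta>) * inverse (\<gamma> * x + \<delta>)"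

end

theory Submission
  imports Defs
begin

text \<open>
  Put \<open>g = f \<circ> a\<inverse>\<close>. By the chain rule \<open>H_op\<close> becomes, at \<open>y = a(x)\<close>, the operator
  \<open>v \<partial>\<^sub>0g - Dg(v)\<close> with \<open>v\<close> the vector part of \<open>y\<close>, so the diffeomorphism drops out.
  The reality conditions force \<open>\<alpha>\<close>, \<open>\<delta>\<close> and \<open>\<beta> - \<alpha>\<gamma>\<inverse>\<delta>\<close> to be real multiples
  of \<open>\<gamma>\<close>, whence \<open>T y = \<gamma> (p + r (y + d)\<inverse>) \<gamma>\<inverse>\<close> with \<open>p\<close>, \<open>r\<close>, \<open>d\<close> real.
  With \<open>w = \<gamma> v \<gamma>\<inverse>\<close>, the vector part of \<open>T y\<close> is a nonzero real multiple of \<open>w\<close>, and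
  the derivative of \<open>T\<close> sends \<open>1\<close> to some \<open>A + B w \<noteq> 0\<close> and \<open>v\<close> to \<open>(A + B w) w\<close>.
  Together with \<open>v \<gamma>\<^sup>* = \<gamma>\<^sup>* w\<close> for the conjugate \<open>\<gamma>\<^sup>*\<close> of \<open>\<gamma>\<close>, this makes the operator
  applied to \<open>\<gamma>\<^sup>* (g \<circ> T)\<close> at \<open>y\<close> equal to \<open>\<gamma>\<^sup>* (A - B w) (w \<partial>\<^sub>0g - Dg(w))\<close>,
  with \<open>g\<close> differentiated at \<open>T y\<close>.
\<close>

section \<open>Linear coordinates and conjugation of quaternions\<close>

lemma bounded_linear_qRe: "bounded_linear qRe"
  by (rule bounded_linear_intro[where K = 1])
    (auto simp: plus_quat_def scaleR_quat_def norm_quat_def intro!: real_le_rsqrt)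

lemma bounded_linear_qVec: "bounded_linear qVec"
  by (rule bounded_linear_intro[where K = 1])
    (auto simp: plus_quat_def scaleR_quat_def norm_quat_def intro!: real_le_rsqrt)

lemma bounded_linear_pure_quat: "bounded_linear pure_quat"
  by (rule bounded_linear_intro[where K = 1])
    (auto simp: pure_quat_def plus_quat_def scaleR_quat_def norm_quat_def)

lemma qRe_1 [simp]: "qRe 1 = 1" and qVec_1 [simp]: "qVec 1 = 0"
  by (simp_all add: one_quat_def)

lemma pure_quat_sel [simp]: "qRe (pure_quat v) = 0" "qVec (pure_quat v) = v"
  by (simp_all add: pure_quat_def)

lemma of_real_quat: "of_real r = Quat r 0"
  by (simp add: of_real_def one_quat_def scaleR_quat_def)

lemma qlift_sel [simp]: "qRe (qlift a x) = qRe x" "qVec (qlift a x) = a (qVec x)"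
  by (simp_all add: qlift_def of_real_quat pure_quat_def plus_quat_def)

lemma qRe_mult_commute: "qRe (x * y) = qRe (y * x)"
  by (simp add: times_quat_def inner_commute mult.commute)

lemma qcnj_eq_scaleR_inverse: "x \<noteq> 0 \<Longrightarrow> qcnj x = (norm x)\<^sup>2 *\<^sub>R inverse x"
  by (simp add: inverse_quat_def)

lemma pure_quat_square: "pure_quat v * pure_quat v = - ((v \<bullet> v) *\<^sub>R 1)"
  by (simp add: pure_quat_def quat_alg_defs cross_refl)

lemma pure_quat_sum: "pure_quat v = (\<Sum>i\<in>UNIV. (v $ i) *\<^sub>R qunit i)"
  using quat_expand[of "pure_quat v"] by simp

lemma open_cyl: "open V \<Longrightarrow> open (cyl s t V)"
proof -
  assume "open V"
  have "cyl s t V = qRe -` einterval s t \<inter> qVec -` V"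
    by (auto simp: cyl_def)
  moreover have "isCont qRe x" "isCont qVec x" for x
    by (auto intro: linear_continuous_at bounded_linear_qRe bounded_linear_qVec)
  ultimately show ?thesis
    using \<open>open V\<close> by (simp add: open_Int continuous_open_vimage)
qed

text \<open>Since \<open>qcnj y * y\<close> is the real number |y|^2, multiplying the real product
  on the right by \<open>y\<close> isolates \<open>x\<close>. This is how the reality conditions
  become proportionality to \<gamma>.\<close>

lemma mult_qcnj_real_imp_scaleR:
  assumes "x * qcnj y \<in> \<real>" "y \<noteq> 0"
  obtains r where "x = r *\<^sub>R y"
proof -
  obtain c where c: "x * qcnj y = of_real c"
    using assms(1) by (auto elim: Reals_cases)
  have "(norm y)\<^sup>2 *\<^sub>R x = x * qcnj y * y"
    using assms(2) by (simp add: qcnj_eq_scaleR_inverse mult.assoc)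
  then have "(norm y)\<^sup>2 *\<^sub>R x = c *\<^sub>R y"
    by (simp add: c scaleR_conv_of_real)
  then have "x = (c / (norm y)\<^sup>2) *\<^sub>R y"
    using assms(2) by (metis divide_inverse_commute norm_eq_zero power_not_zero scaleR_left_imp_eq
        scaleR_scaleR right_inverse mult_1)
  then show thesis by (rule that)
qed

section \<open>Derivatives of lifts and Moebius maps; the operator in terms of total
  derivatives\<close>

lemma partial_deriv_eq:
  assumes "(f has_derivative f') (at x)"
  shows "partial_deriv f e x = f' e"
proof -
  have "((\<lambda>h. x + h *\<^sub>R e) has_derivative (\<lambda>h. h *\<^sub>R e)) (at 0)"
    by (auto intro!: derivative_eq_intros)
  then have "((\<lambda>h. f (x + h *\<^sub>R e)) has_derivative (\<lambda>h. f' (h *\<^sub>R e))) (at 0)"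
    by (rule has_derivative_compose) (use assms in simp)
  moreover have "f' (h *\<^sub>R e) = h *\<^sub>R f' e" for h
    using assms by (simp add: has_derivative_def linear_simps)
  ultimately have "((\<lambda>h. f (x + h *\<^sub>R e)) has_vector_derivative f' e) (at 0)"
    by (simp add: has_vector_derivative_def)
  then show ?thesis
    unfolding partial_deriv_def by (rule vector_derivative_at)
qed

text \<open>By linearity of \<open>b'\<close> the sum over \<open>j\<close> collapses to coordinate
  \<open>i\<close> of \<open>b' (a (qVec x))\<close>; by linearity of \<open>f'\<close> the sum over
  \<open>i\<close> then becomes a single directional derivative.\<close>

lemma H_op_eq:
  assumes f: "(f has_derivative f') (at x)"
    and b: "(inv_into U a has_derivative b') (at (a (qVec x)))"
  shows "H_op U a f x =
    pure_quat (a (qVec x)) * f' 1 - f' (pure_quat (b' (a (qVec x))))"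
proof -
  let ?v = "a (qVec x)"
  interpret f: bounded_linear f' using f by (rule has_derivative_bounded_linear)
  interpret b: bounded_linear b' using b by (rule has_derivative_bounded_linear)
  have "((\<lambda>y. inv_into U a y $ i) has_derivative (\<lambda>h. b' h $ i)) (at ?v)" for i
    by (rule bounded_linear.has_derivative[OF bounded_linear_vec_nth b])
  then have pd: "partial_deriv (\<lambda>y. inv_into U a y $ i) (axis j 1) ?v = b' (axis j 1) $ i" for i j
    by (rule partial_deriv_eq)
  have "b' ?v = b' (\<Sum>j\<in>UNIV. (?v $ j) *\<^sub>R axis j 1)"
    by (simp add: basis_expansion flip: scalar_mult_eq_scaleR)
  also have "\<dots> = (\<Sum>j\<in>UNIV. (?v $ j) *\<^sub>R b' (axis j 1))"
    by (simp add: b.sum b.scaleR)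
  finally have coef: "(\<Sum>j\<in>UNIV. ?v $ j * b' (axis j 1) $ i) = b' ?v $ i" for i
    by (simp)
  show ?thesis
    unfolding H_op_def pd partial_deriv_eq[OF f] coef
    by (simp add: pure_quat_sum[of "b' ?v"] f.sum f.scaleR)
qed

lemma has_derivative_qlift:
  assumes "(b has_derivative b') (at (qVec z))"
  shows "(qlift b has_derivative (\<lambda>e. of_real (qRe e) + pure_quat (b' (qVec e)))) (at z)"
proof -
  have "((\<lambda>z. b (qVec z)) has_derivative (\<lambda>e. b' (qVec e))) (at z)"
    by (rule has_derivative_compose[OF bounded_linear_imp_has_derivative[OF bounded_linear_qVec] assms])
  then show ?thesis
    unfolding qlift_def
    by (intro has_derivative_add bounded_linear.has_derivative[OF bounded_linear_pure_quat]
        bounded_linear.has_derivative[OF bounded_linear_of_real]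
        bounded_linear_imp_has_derivative[OF bounded_linear_qRe])
qed

text \<open>Replaces the chosen inverse by a formula that can be differentiated.\<close>

lemma qlift_inv_eq:
  assumes "bij_betw a U V" "z \<in> cyl s t V"
  shows "qlift_inv s t U a z = qlift (inv_into U a) z"
proof -
  have "inj_on a U" using assms(1) by (rule bij_betw_imp_inj_on)
  then have inj: "inj_on (qlift a) (cyl s t U)"
    by (auto simp: inj_on_def cyl_def quat_eq_iff dest!: arg_cong[of "qlift a _" _ qRe] 
      arg_cong[of "qlift a _" _ qVec])
  have v: "qVec z \<in> V" using assms(2) by (simp add: cyl_def)
  show ?thesis
    unfolding qlift_inv_def
  proof (rule inv_into_f_eq[OF inj])
    show "qlift (inv_into U a) z \<in> cyl s t U"
      using assms v bij_betw_apply[OF bij_betw_inv_into[OF assms(1)] v] by (simp add: cyl_def)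
    show "qlift a (qlift (inv_into U a) z) = z"
      using bij_betw_inv_into_right[OF assms(1) v] by (simp add: quat_eq_iff)
  qed
qed

text \<open>With q = \<gamma> y + \<delta>, the derivative of q^-1 along \<open>e\<close> is - q^-1
  \<gamma> e q^-1; factoring q^-1 out on the right leaves T y in front of \<gamma>.\<close>

lemma has_derivative_qmoebius:
  assumes "\<gamma> * y + \<delta> \<noteq> 0"
  shows "(qmoebius \<alpha> \<beta> \<gamma> \<delta> has_derivative
    (\<lambda>e. (\<alpha> - qmoebius \<alpha> \<beta> \<gamma> \<delta> y * \<gamma>) * e * inverse (\<gamma> * y + \<delta>))) (at y)"
  unfolding qmoebius_def using assms
  by (auto intro!: derivative_eq_intros simp: algebra_simps)

section \<open>The operator under a Moebius map\<close>

lemma intertwining_identity: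
  fixes G :: "quat \<Rightarrow> quat"
  assumes "linear G" and "J * g = g * w" and "w * w = - (n *\<^sub>R 1)"
  shows "J * (g * G (A *\<^sub>R 1 + B *\<^sub>R w)) - g * G (A *\<^sub>R w - (B * n) *\<^sub>R 1)
    = g * ((A *\<^sub>R 1 - B *\<^sub>R w) * (w * G 1 - G w))"
proof -
  have "w * (w * z) = - (n *\<^sub>R z)" for z
    using arg_cong[OF assms(3), of "\<lambda>u. u * z"] by (simp add: mult.assoc)
  moreover have "J * (g * z) = g * (w * z)" for z
    using arg_cong[OF assms(2), of "\<lambda>u. u * z"] by (simp add: mult.assoc)
  \<comment> \<open>\<open>G\<close> is only real-linear, so \<open>w\<close> cannot be pulled out
    of it. The minus sign in A - B w comes from w^2 = - n: the term B n G(1) on the left is - B w (w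
    G(1)) on the right.\<close>
  ultimately show ?thesis
    by (simp add: linear_add[OF assms(1)] linear_diff[OF assms(1)] linear_scale[OF assms(1)]
        algebra_simps)
qed

text \<open>A real shift leaves the vector part alone, and the inverse is the conjugate over the
  squared norm, so \<open>k1\<close> is -1/|y + d|^2.\<close>

lemma inverse_eq_real_plus_pure:
  assumes "y + of_real d \<noteq> 0"
  obtains k0 k1 where "inverse (y + of_real d) = k0 *\<^sub>R 1 + k1 *\<^sub>R pure_quat (qVec y)" "k1 \<noteq> 0"
proof -
  let ?N = "(norm (y + of_real d))\<^sup>2"
  have "inverse (y + of_real d) =
      ((qRe y + d) / ?N) *\<^sub>R 1 + (- inverse ?N) *\<^sub>R pure_quat (qVec y)"
    by (simp add: inverse_quat_def qcnj_def quat_alg_defs of_real_quat pure_quat_def divide_inverse)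
  then show thesis
    by (rule that) (use assms in simp)
qed

text \<open>The theorem at one point, with the diffeomorphism removed: \<open>G\<close> stands for
  the derivative of g at T y, and \<open>T'\<close> for that of T at y.\<close>

lemma moebius_intertwining:
  fixes G :: "quat \<Rightarrow> quat"
  assumes G: "linear G" and "\<gamma> \<noteq> 0"
    and eps: "\<beta> - \<alpha> * inverse \<gamma> * \<delta> \<noteq> 0"
    and "\<alpha> * qcnj \<gamma> \<in> \<real>" "(\<beta> - \<alpha> * inverse \<gamma> * \<delta>) * qcnj \<gamma> \<in> \<real>"
      "\<delta> * qcnj (\<beta> - \<alpha> * inverse \<gamma> * \<delta>) \<in> \<real>"
    and nz: "\<gamma> * y + \<delta> \<noteq> 0"
    and "v = pure_quat (qVec y)"
    and "v' = pure_quat (qVec (qmoebius \<alpha> \<beta> \<gamma> \<delta> y))"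
    and T': "\<And>e. T' e = (\<alpha> - qmoebius \<alpha> \<beta> \<gamma> \<delta> y * \<gamma>) * e * inverse (\<gamma> * y + \<delta>)"
  shows "v * (qcnj \<gamma> * G (T' 1)) - qcnj \<gamma> * G (T' v) = 0 \<longleftrightarrow> v' * G 1 - G v' = 0"
proof -
  define \<epsilon> where "\<epsilon> = \<beta> - \<alpha> * inverse \<gamma> * \<delta>"
  obtain p where p: "\<alpha> = p *\<^sub>R \<gamma>"
    using mult_qcnj_real_imp_scaleR assms(2,4) by blast
  obtain r where r: "\<epsilon> = r *\<^sub>R \<gamma>"
    using mult_qcnj_real_imp_scaleR assms(2,5) unfolding \<epsilon>_def by blast
  have "r \<noteq> 0" using eps r by (auto simp: \<epsilon>_def)
  obtain d' where "\<delta> = d' *\<^sub>R \<epsilon>"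
    using mult_qcnj_real_imp_scaleR assms(3,6) unfolding \<epsilon>_def by blast
  then obtain d where d: "\<delta> = d *\<^sub>R \<gamma>" using r scaleR_scaleR by metis
  define k where "k = inverse (y + of_real d)"
  have den: "\<gamma> * y + \<delta> = \<gamma> * (y + of_real d)"
    by (simp add: d distrib_left of_real_def)
  then have yd: "y + of_real d \<noteq> 0" using nz by auto
  then obtain k0 k1 where k: "k = k0 *\<^sub>R 1 + k1 *\<^sub>R v" and "k1 \<noteq> 0"
    using inverse_eq_real_plus_pure assms(8) k_def by metis
  have q: "inverse (\<gamma> * y + \<delta>) = k * inverse \<gamma>"
    using yd \<open>\<gamma> \<noteq> 0\<close> by (simp add: den k_def nonzero_inverse_mult_distrib)
  have beta: "\<beta> = \<epsilon> + p *\<^sub>R \<delta>"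
    using \<open>\<gamma> \<noteq> 0\<close> by (simp add: \<epsilon>_def p)
  have "qmoebius \<alpha> \<beta> \<gamma> \<delta> y = (p *\<^sub>R (\<gamma> * y + \<delta>) + \<epsilon>) * inverse (\<gamma> * y + \<delta>)"
    by (simp add: qmoebius_def beta p algebra_simps)
  also have "\<dots> = p *\<^sub>R 1 + \<epsilon> * inverse (\<gamma> * y + \<delta>)"
    by (simp only: distrib_right[of _ \<epsilon>] mult_scaleR_left right_inverse[OF nz])
  finally have T: "qmoebius \<alpha> \<beta> \<gamma> \<delta> y = p *\<^sub>R 1 + r *\<^sub>R (\<gamma> * k * inverse \<gamma>)"
    by (simp add: q r mult.assoc)
  have cancel: "inverse \<gamma> * (\<gamma> * z) = z" for z
    using \<open>\<gamma> \<noteq> 0\<close> by (simp flip: mult.assoc)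
  \<comment> \<open>The left factor \<alpha> - T y \<gamma> equals - r \<gamma> k; the second
    \<open>k\<close> comes from \<open>q\<close>.\<close>
  have T'_eq: "T' e = (- r) *\<^sub>R (\<gamma> * (k * e * k) * inverse \<gamma>)" for e
    using \<open>\<gamma> \<noteq> 0\<close> unfolding T' T q by (simp add: p algebra_simps)

  define w where "w = \<gamma> * v * inverse \<gamma>"
  define n where "n = qVec y \<bullet> qVec y"
  \<comment> \<open>\<open>A\<close> and \<open>B\<close> are the coordinates of - r k^2 with
    respect to 1 and \<open>v\<close>. Since \<open>k\<close> commutes with \<open>v\<close>, k v k
    = k^2 v, and v^2 = - n turns the \<open>B\<close> part into - B n.\<close>
  define A where "A = - r * (k0\<^sup>2 - k1\<^sup>2 * n)"
  define B where "B = - r * (2 * k0 * k1)"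
  have vv: "v * v = - (n *\<^sub>R 1)"
    unfolding assms(8) n_def by (rule pure_quat_square)
  have vvz: "v * (v * z) = - (n *\<^sub>R z)" for z
    using arg_cong[OF vv, of "\<lambda>u. u * z"] by (simp add: mult.assoc)
  have ww: "w * w = - (n *\<^sub>R 1)"
    using \<open>\<gamma> \<noteq> 0\<close> by (simp add: w_def mult.assoc cancel vvz)
  \<comment> \<open>The weight \<open>qcnj \<gamma>\<close> is a real multiple of
    \<open>inverse \<gamma>\<close>, so it undoes the conjugation in \<open>w\<close>.\<close>
  have vg: "v * qcnj \<gamma> = qcnj \<gamma> * w"
    using \<open>\<gamma> \<noteq> 0\<close> by (simp add: qcnj_eq_scaleR_inverse w_def mult.assoc cancel)
  have conj: "\<gamma> * (c *\<^sub>R 1 + c' *\<^sub>R v) * inverse \<gamma> = c *\<^sub>R 1 + c' *\<^sub>R w" for c c'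
    using \<open>\<gamma> \<noteq> 0\<close> by (simp add: w_def algebra_simps)
  have "(- r) *\<^sub>R (k * 1 * k) = A *\<^sub>R 1 + B *\<^sub>R v"
    by (simp add: k A_def B_def vv algebra_simps power2_eq_square scaleR_2 flip: scaleR_add_left)
  then have T'1: "T' 1 = A *\<^sub>R 1 + B *\<^sub>R w"
    unfolding T'_eq by (metis conj mult_scaleR_left mult_scaleR_right)
  have "(- r) *\<^sub>R (k * v * k) = (- (B * n)) *\<^sub>R 1 + A *\<^sub>R v"
    by (simp add: k A_def B_def vv vvz algebra_simps power2_eq_square scaleR_2 flip: scaleR_add_left)
  then have "T' v = (- (B * n)) *\<^sub>R 1 + A *\<^sub>R w"
    unfolding T'_eq by (metis conj mult_scaleR_left mult_scaleR_right)
  then have T'v: "T' v = A *\<^sub>R w - (B * n) *\<^sub>R 1"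
    by simp
  have "T' 1 \<noteq> 0"
    using \<open>\<gamma> \<noteq> 0\<close> \<open>r \<noteq> 0\<close> yd by (simp add: T'_eq k_def)
  have "qRe w = qRe (inverse \<gamma> * (\<gamma> * v))"
    unfolding w_def by (rule qRe_mult_commute)
  then have Rew: "qRe w = 0"
    using \<open>\<gamma> \<noteq> 0\<close> by (simp add: assms(8) cancel)
  \<comment> \<open>As \<open>w\<close> has no real part, this is the conjugate of
    \<open>T' 1\<close>, hence nonzero with it.\<close>
  have AB: "A *\<^sub>R 1 - B *\<^sub>R w \<noteq> 0"
    using \<open>T' 1 \<noteq> 0\<close> Rew unfolding T'1 by (auto simp: quat_alg_defs)
  have "qmoebius \<alpha> \<beta> \<gamma> \<delta> y = (p + r * k0) *\<^sub>R 1 + (r * k1) *\<^sub>R w"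
    using \<open>\<gamma> \<noteq> 0\<close> by (simp add: T k w_def algebra_simps)
  then have v': "v' = (r * k1) *\<^sub>R w"
    using Rew by (simp add: assms(9) pure_quat_def quat_alg_defs)
  have "qcnj \<gamma> \<noteq> 0" using \<open>\<gamma> \<noteq> 0\<close> by (simp add: qcnj_eq_scaleR_inverse)
  then have "v * (qcnj \<gamma> * G (T' 1)) - qcnj \<gamma> * G (T' v) = 0 \<longleftrightarrow> w * G 1 - G w = 0"
    unfolding T'1 T'v intertwining_identity[OF G vg ww] using AB by simp
  also have "\<dots> \<longleftrightarrow> v' * G 1 - G v' = 0"
    using \<open>r \<noteq> 0\<close> \<open>k1 \<noteq> 0\<close> by (simp add: v' linear_scale[OF G] flip: scaleR_diff_right)
  finally show ?thesis .
qed

section \<open>Transfer of the pointwise equivalence to \<open>H_op\<close>\<close>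

theorem corollary3p30:
  fixes U V :: "(real ^ 3) set" and s t :: ereal
    and a :: "real ^ 3 \<Rightarrow> real ^ 3"
    and \<Omega> :: "quat set" and \<alpha> \<beta> \<gamma> \<delta> :: quat
    and f :: "quat \<Rightarrow> quat"
  assumes "is_domain U" and "is_domain V"
    and "s < t"
    and "C1_diffeomorphism a U V"
    and "is_domain \<Omega>"
    and "\<gamma> \<noteq> 0" and "\<beta> - \<alpha> * inverse \<gamma> * \<delta> \<noteq> 0"
    and "\<alpha> * qcnj \<gamma> \<in> \<real>"
    and "(\<beta> - \<alpha> * inverse \<gamma> * \<delta>) * qcnj \<gamma> \<in> \<real>"
    and "\<delta> * qcnj (\<beta> - \<alpha> * inverse \<gamma> * \<delta>) \<in> \<real>"
    and "\<And>x. x \<in> \<Omega> \<Longrightarrow> \<gamma> * x + \<delta> \<noteq> 0"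
    and "\<Omega> \<subseteq> cyl s t V" and "qmoebius \<alpha> \<beta> \<gamma> \<delta> ` \<Omega> \<subseteq> cyl s t V"
    and "C1_on f (qlift_inv s t U a ` qmoebius \<alpha> \<beta> \<gamma> \<delta> ` \<Omega>)"
  shows "(\<forall>x \<in> qlift_inv s t U a ` qmoebius \<alpha> \<beta> \<gamma> \<delta> ` \<Omega>. H_op U a f x = 0) \<longleftrightarrow>
    (\<forall>x \<in> qlift_inv s t U a ` \<Omega>.
       H_op U a
         (\<lambda>z. qcnj \<gamma> * (f \<circ> qlift_inv s t U a \<circ> qmoebius \<alpha> \<beta> \<gamma> \<delta> \<circ> qlift a) z) x = 0)"
proof -
  define b where "b = inv_into U a"
  define T where "T = qmoebius \<alpha> \<beta> \<gamma> \<delta>"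
  define h where "h = (\<lambda>z. qcnj \<gamma> * (f \<circ> qlift_inv s t U a \<circ> T \<circ> qlift a) z)"
  have bij: "bij_betw a U V" and "C1_on a U" and "C1_on b V"
    using assms(4) by (auto simp: C1_diffeomorphism_def b_def)
  have "open U" "open V" using assms(1,2) by (auto simp: is_domain_def)
  \<comment> \<open>Both sets are images of \<Omega>, so it suffices to compare the operators at
    points coming from the same \<open>y\<close>.\<close>
  have "H_op U a f (qlift_inv s t U a (T y)) = 0 \<longleftrightarrow> H_op U a h (qlift_inv s t U a y) = 0"
    if y: "y \<in> \<Omega>" for y
  proof -
    have yV: "y \<in> cyl s t V" and TyV: "T y \<in> cyl s t V"
      using y assms(12,13) by (auto simp: T_def)
    then have vV: "qVec y \<in> V" and TvV: "qVec (T y) \<in> V"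
      by (auto simp: cyl_def)
    define x where "x = qlift b y"
    define x' where "x' = qlift b (T y)"
    have x: "qlift_inv s t U a y = x" and x': "qlift_inv s t U a (T y) = x'"
      using qlift_inv_eq[OF bij yV] qlift_inv_eq[OF bij TyV] by (simp_all add: x_def x'_def b_def)
    have ab: "a (b u) = u" "b u \<in> U" if "u \<in> V" for u
      using that bij_betw_inv_into_right[OF bij that] bij_betw_apply[OF bij_betw_inv_into[OF bij] that]
      by (simp_all add: b_def)
    have ax: "a (qVec x) = qVec y" and ax': "a (qVec x') = qVec (T y)" and xU: "qVec x \<in> U"
      using ab vV TvV by (simp_all add: x_def x'_def)
    have lx: "qlift a x = y"
      using ax by (simp add: quat_eq_iff x_def)
    obtain a' where a': "(a has_derivative a') (at (qVec x))"
      using \<open>C1_on a U\<close> xU unfolding C1_on_def by blast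
    obtain b1 where b1: "(b has_derivative b1) (at (qVec y))"
      using \<open>C1_on b V\<close> vV unfolding C1_on_def by blast
    obtain b2 where b2: "(b has_derivative b2) (at (qVec (T y)))"
      using \<open>C1_on b V\<close> TvV unfolding C1_on_def by blast
    obtain f' where f': "(f has_derivative f') (at x')"
      using assms(14) y unfolding C1_on_def x'[symmetric] T_def by blast
    \<comment> \<open>Differentiating a(b(z)) = z on \<open>V\<close>. This cancels the derivative
      of the inverse in \<open>H_op\<close> against that of \<open>a\<close> inside
      \<open>h\<close>.\<close>
    have a'b1: "a' (b1 u) = u" for u
    proof -
      have "((\<lambda>z. a (b z)) has_derivative (\<lambda>u. a' (b1 u))) (at (qVec y))"
        by (rule has_derivative_compose[OF b1]) (use a' in \<open>simp add: x_def\<close>)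
      then have "((\<lambda>z. z) has_derivative (\<lambda>u. a' (b1 u))) (at (qVec y))"
        by (rule has_derivative_transform_within_open[OF _ \<open>open V\<close> vV]) (simp add: ab)
      then have "(\<lambda>u. a' (b1 u)) = (\<lambda>u. u)"
        by (rule has_derivative_unique) (rule has_derivative_ident)
      then show ?thesis by metis
    qed
    define T' where "T' e = (\<alpha> - T y * \<gamma>) * e * inverse (\<gamma> * y + \<delta>)" for e
    define G where "G e = f' (of_real (qRe e) + pure_quat (b2 (qVec e)))" for e
    have dT: "(T has_derivative T') (at y)"
      unfolding T'_def T_def by (rule has_derivative_qmoebius) (use assms(11) y in blast)
    have "((\<lambda>z. f (qlift b z)) has_derivative G) (at (T y))"
      unfolding G_def
      by (rule has_derivative_compose[OF has_derivative_qlift[OF b2]]) (use f' in \<open>simp add: x'_def\<close>)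
    \<comment> \<open>The formula for \<open>qlift_inv\<close> is known only on the cylinder, which
      is open and contains \<open>T y\<close>.\<close>
    then have dg: "((\<lambda>z. f (qlift_inv s t U a z)) has_derivative G) (at (T y))"
      by (rule has_derivative_transform_within_open[OF _ open_cyl[OF \<open>open V\<close>] TyV])
        (simp add: qlift_inv_eq[OF bij] b_def)
    then have "linear G"
      by (rule has_derivative_linear)
    have "((\<lambda>z. T (qlift a z)) has_derivative
        (\<lambda>e. T' (of_real (qRe e) + pure_quat (a' (qVec e))))) (at x)"
      by (rule has_derivative_compose[OF has_derivative_qlift[OF a']]) (use dT in \<open>simp add: lx\<close>)
    then have "((\<lambda>z. f (qlift_inv s t U a (T (qlift a z)))) has_derivative
        (\<lambda>e. G (T' (of_real (qRe e) + pure_quat (a' (qVec e)))))) (at x)"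
      by (rule has_derivative_compose) (use dg in \<open>simp add: lx\<close>)
    then have dh: "(h has_derivative
        (\<lambda>e. qcnj \<gamma> * G (T' (of_real (qRe e) + pure_quat (a' (qVec e)))))) (at x)"
      unfolding h_def o_def by (rule has_derivative_mult_right)
    \<comment> \<open>The direction 1 has no vector part, so the derivatives of the lifts fix
      it.\<close>
    have a'0: "pure_quat (a' 0) = 0" "pure_quat (b2 0) = 0"
      using has_derivative_linear[OF a'] has_derivative_linear[OF b2]
      by (simp_all add: linear_0 pure_quat_def zero_quat_def)
    have "H_op U a h x = pure_quat (qVec y) * (qcnj \<gamma> * G (T' 1))
        - qcnj \<gamma> * G (T' (pure_quat (qVec y)))"
      using H_op_eq[OF dh, of U a b1] b1 ax by (simp add: b_def a'0 a'b1)
    moreover have "H_op U a f x' = pure_quat (qVec (T y)) * G 1 - G (pure_quat (qVec (T y)))"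
      using H_op_eq[OF f', of U a b2] b2 ax' by (simp add: b_def a'0 G_def)
    ultimately show ?thesis
      using moebius_intertwining[OF \<open>linear G\<close> assms(6-10) assms(11)[OF y] refl refl
          T'_def[unfolded T_def]]
      by (simp only: x x' flip: T_def)
  qed
  then show ?thesis
    by (simp add: h_def T_def)
qed

end
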